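(* Given a normalized diagonally dominant and invertible matrix $W\in\mathbb{R}^{n\times n}$, and while considering only fair runs, there are constants $c_1,c_2$, where $c_1>0$ and $1>c_2>0$, such that the algorithm Async-SS-Iterative (associated with $W$) $\epsilon$-always converges with $$\epsilon(\Delta t,\delta,\mathcal{C})=\delta\cdot c_1+(c_2)^{\Delta t}\cdot z,$$ where $\Delta t$ counts the asynchronous rounds of a fair run. Here, for inputs that are $\delta$-bounded around $v$, with $u$ the solution to $v$, $z=\max_i|O_{p_i}(0)-u_i|$, where $O(0)$ is the output vector of the configuration $\mathcal{C}=\mathcal{C}_0$ from which the run starts.
   Context: Setting: a directed graph on nodes $p_1,\dots,p_n$ with real edge weights $w_{p_i,p_j}$ (possibly negative), where $w_{p_i,p_i}\neq 0$ for all $i$, and $w_{p_i,p_j}=0$ means there is no edge between $p_i$ and $p_j$. $N(p_i)$ denotes the neighbors of $p_i$. The weights are part of the code and are not subject to faults. The matrix $W$ has entries $W_{ii}=1/w_{p_i,p_i}$ and $W_{ij}=-w_{p_i,p_j}/w_{p_i,p_i}$ for $i\neq j$. For $v\in\mathbb{R}^n$, the solution to $v$ is the unique $u\in\mathbb{R}^n$ with $u_i=w_{p_i,p_i}v_i+\sum_{j\neq i}w_{p_i,p_j}u_j$ for all $i$, equivalently $Wu=v$. A matrix $M\in\mathbb{R}^{n\times n}$ is diagonally dominant if $|M_{ii}|>\sum_{j\neq i}|M_{ij}|$ for every $i$; it is normalized diagonally dominant if in addition $|M_{ii}|\ge 1$ for every $i$. $\|x\|_\infty=\max_i|x_i|$.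 Communication is by shared memory: for each directed edge between $p_i,p_j$ there is a read-write register $R_{p_i,p_j}$ written by $p_i$ and read by $p_j$. Algorithm Async-SS-Iterative, executed on each node $p_i$: forever do the following. (Phase 1) For each $p_j\in N(p_i)$, write $O_{p_i}$ to $R_{p_i,p_j}$. (Phase 2) Set $O_{p_i}:=w_{p_i,p_i}\cdot I_{p_i}$, where $I_{p_i}$ is the current input of $p_i$; then for each $p_j\in N(p_i)$, read $R_{p_j,p_i}$ into a local variable temp and update $O_{p_i}:=O_{p_i}+w_{p_i,p_j}\cdot \text{temp}$. A configuration consists of all of the registers and of the local variables at the different nodes. An asynchronous run is an infinite sequence of configurations $\mathcal{C}_0\to\mathcal{C}_1\to\cdots$ such that some node performs an atomic step between $\mathcal{C}_r$ and $\mathcal{C}_{r+1}$; an atomic step consists of reading or writing from a single register. Each configuration $\mathcal{C}_r$ is assigned an input vector $I(r)\in\mathbb{R}^n$, such that if $p_i$ reads its input when performing an atomic step on $\mathcal{C}_r$, it reads $I_{p_i}(r)$; the output vector of $\mathcal{C}_r$ is denoted $O(r)$, with components $O_{p_i}(r)$. A run is fair if each node performs an atomic step infinitely many times. A round is the shortest prefix of a run such that each node has performed all the lines of the loop body (both phases) of the algorithm; rounds are numbered consecutively, and a round consists of many atomic steps. An input sequence is $\delta$-bounded around $v$ if each of its vectors $v'$ satisfies $\|v'-v\|_\infty\le\delta$. A run from configuration $\mathcal{C}$ on an input sequence that is $\delta$-bounded around $v$ $\epsilon$-converges to its solution if the output vector at time $\Delta t$ is at $\|\cdot\|_\infty$-distance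 at most $\epsilon(\Delta t,\delta,\mathcal{C})$ from the solution $u$ to $v$; here time is counted in asynchronous rounds. An algorithm $\epsilon$-always converges if for every $\delta$-bounded input sequence, every run on it, from any configuration, $\epsilon$-converges to its solution (here: every fair run).
   Formalization: The stated bound fails for stale registers and partial sums; here z is replaced by z + c3·(register/output mismatch and corrupted initial partial sums, zero for coherent starts outside Phase 2), and a node's output during Phase 2 is its last value outside Phase 2 (or its initial value). *)

theory Defs
  imports "HOL-Analysis.Analysis"
begin

section \<open>Weights, matrix and solution\<close>

definition system_matrix :: "real^'n^'n \<Rightarrow> real^'n^'n" where
  "system_matrix w =
     (\<chi> i j. if i = j then 1 / (w $ i $ i) else - (w $ i $ j) / (w $ i $ i))"

definition solution :: "real^'n^'n \<Rightarrow> real^'n \<Rightarrow> real^'n" where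
  "solution w v =
     (THE u. \<forall>i. u $ i = w $ i $ i * v $ i + (\<Sum>j\<in>UNIV - {i}. w $ i $ j * u $ j))"

definition diagonally_dominant :: "real^'n^'n \<Rightarrow> bool" where
  "diagonally_dominant M \<longleftrightarrow> (\<forall>i. \<bar>M $ i $ i\<bar> > (\<Sum>j\<in>UNIV - {i}. \<bar>M $ i $ j\<bar>))"

definition normalized_diagonally_dominant :: "real^'n^'n \<Rightarrow> bool" where
  "normalized_diagonally_dominant M \<longleftrightarrow>
     diagonally_dominant M \<and> (\<forall>i. \<bar>M $ i $ i\<bar> \<ge> 1)"

section \<open>The asynchronous algorithm\<close>

text \<open>Neighbourhood ignores the direction of edges: an edge with \<open>w $ j $ i \<noteq> 0\<close> obliges
  \<open>i\<close> to write to \<open>j\<close>, even if \<open>w $ i $ j = 0\<close>.\<close>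

definition neighbors :: "real^'n^'n \<Rightarrow> 'n \<Rightarrow> 'n set" where
  "neighbors w i = {j. j \<noteq> i \<and> (w $ i $ j \<noteq> 0 \<or> w $ j $ i \<noteq> 0)}"

text \<open>The control location of a node records which neighbours the current for-loop still has to
  treat; the order is left open. \<open>Writing {}\<close> means that the next action reads the input, so a
  node is at \<open>Reading S\<close> exactly while its output variable holds a partial sum.\<close>

datatype 'n location = Writing "'n set" | Reading "'n set"

datatype 'n action = Write 'n | ReadInput | Read 'n

record 'n config =
  reg :: "'n \<Rightarrow> 'n \<Rightarrow> real"  \<comment> \<open>\<open>reg C i j\<close> is written by \<open>i\<close> and read by \<open>j\<close>\<close>
  out :: "'n \<Rightarrow> real"
  temp :: "'n \<Rightarrow> real"
  loc :: "'n \<Rightarrow> 'n location"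

definition valid_config :: "real^'n^'n \<Rightarrow> 'n config \<Rightarrow> bool" where
  "valid_config w C \<longleftrightarrow>
     (\<forall>i. case loc C i of Writing S \<Rightarrow> S \<subseteq> neighbors w i
                        | Reading S \<Rightarrow> S \<subseteq> neighbors w i \<and> S \<noteq> {})"

definition reading_location :: "real^'n^'n \<Rightarrow> 'n \<Rightarrow> 'n set \<Rightarrow> 'n location" where
  "reading_location w i S = (if S = {} then Writing (neighbors w i) else Reading S)"

text \<open>\<open>step w x C i a C'\<close>: with input vector \<open>x\<close>, node \<open>i\<close> performs the action \<open>a\<close>.
  Every action accesses one register, the input counting as a register; the local computation
  that goes with the access belongs to the same step.\<close>

inductive step ::
  "real^'n^'n \<Rightarrow> real^'n \<Rightarrow> 'n config \<Rightarrow> 'n \<Rightarrow> 'n action \<Rightarrow> 'n config \<Rightarrow> bool"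
  for w :: "real^'n^'n" and x :: "real^'n" and C :: "'n config" where
  write_reg: "loc C i = Writing S \<Longrightarrow> j \<in> S \<Longrightarrow>
    step w x C i (Write j)
      (C\<lparr>reg := (reg C)(i := (reg C i)(j := out C i)),
         loc := (loc C)(i := Writing (S - {j}))\<rparr>)"
| read_inp: "loc C i = Writing {} \<Longrightarrow>
    step w x C i ReadInput
      (C\<lparr>out := (out C)(i := w $ i $ i * x $ i),
         loc := (loc C)(i := reading_location w i (neighbors w i))\<rparr>)"
| read_reg: "loc C i = Reading S \<Longrightarrow> j \<in> S \<Longrightarrow>
    step w x C i (Read j)
      (C\<lparr>temp := (temp C)(i := reg C j i),
         out := (out C)(i := out C i + w $ i $ j * reg C j i),
         loc := (loc C)(i := reading_location w i (S - {j}))\<rparr>)"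

text \<open>\<open>act r\<close> is the node performing the step from \<open>C r\<close> to \<open>C (Suc r)\<close>, with its action.\<close>

definition is_run ::
  "real^'n^'n \<Rightarrow> (nat \<Rightarrow> real^'n) \<Rightarrow> (nat \<Rightarrow> 'n config) \<Rightarrow> (nat \<Rightarrow> 'n \<times> 'n action) \<Rightarrow> bool"
  where
  "is_run w inp C act \<longleftrightarrow>
     valid_config w (C 0) \<and>
     (\<forall>r. step w (inp r) (C r) (fst (act r)) (snd (act r)) (C (Suc r)))"

definition fair :: "(nat \<Rightarrow> 'n \<times> 'n action) \<Rightarrow> bool" where
  "fair act \<longleftrightarrow> (\<forall>i. \<exists>\<^sub>\<infinity>r. fst (act r) = i)"

section \<open>Rounds\<close>

definition loop_body :: "real^'n^'n \<Rightarrow> 'n \<Rightarrow> 'n action set" where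
  "loop_body w i = Write ` neighbors w i \<union> {ReadInput} \<union> Read ` neighbors w i"

text \<open>In a fair run the least element always exists.\<close>

primrec round_end :: "real^'n^'n \<Rightarrow> (nat \<Rightarrow> 'n \<times> 'n action) \<Rightarrow> nat \<Rightarrow> nat" where
  "round_end w act 0 = 0"
| "round_end w act (Suc k) =
     (LEAST t. \<forall>i. \<forall>a\<in>loop_body w i. \<exists>r\<in>{round_end w act k..<t}. act r = (i, a))"

section \<open>Convergence\<close>

text \<open>In the middle of Phase 2 the output variable of a node holds a partial sum, which is not an
  output; the node's output is then the last value it held outside Phase 2 (or the value in the
  initial configuration).\<close>

primrec node_output :: "(nat \<Rightarrow> 'n config) \<Rightarrow> 'n \<Rightarrow> nat \<Rightarrow> real" where
  "node_output C i 0 = out (C 0) i"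
| "node_output C i (Suc r) =
     (case loc (C (Suc r)) i of
        Writing S \<Rightarrow> out (C (Suc r)) i
      | Reading S \<Rightarrow> node_output C i r)"

definition output_vector :: "(nat \<Rightarrow> 'n config) \<Rightarrow> nat \<Rightarrow> real^'n" where
  "output_vector C r = (\<chi> i. node_output C i r)"

definition bounded_around :: "real \<Rightarrow> real^'n \<Rightarrow> (nat \<Rightarrow> real^'n) \<Rightarrow> bool" where
  "bounded_around \<delta> v inp \<longleftrightarrow> (\<forall>r. infnorm (inp r - v) \<le> \<delta>)"

text \<open>The error bound \<open>eps\<close> takes the number of rounds, \<open>\<delta>\<close>, the initial configuration and the
  solution. Time \<open>k\<close> comprises all configurations of the run in which exactly \<open>k\<close> rounds are
  complete.\<close>

definition eps_always_converges ::
  "real^'n^'n \<Rightarrow> (nat \<Rightarrow> real \<Rightarrow> 'n config \<Rightarrow> real^'n \<Rightarrow> real) \<Rightarrow> bool" where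
  "eps_always_converges w eps \<longleftrightarrow>
     (\<forall>\<delta> v inp C act.
        bounded_around \<delta> v inp \<longrightarrow> is_run w inp C act \<longrightarrow> fair act \<longrightarrow>
        (\<forall>k r. round_end w act k \<le> r \<longrightarrow> r < round_end w act (Suc k) \<longrightarrow>
           infnorm (output_vector C r - solution w v) \<le> eps k \<delta> (C 0) (solution w v)))"

definition initial_error :: "'n::finite config \<Rightarrow> real^'n \<Rightarrow> real" where
  "initial_error C u = (MAX i. \<bar>out C i - u $ i\<bar>)"

text \<open>A configuration contains more than its outputs. \<open>corruption\<close> measures the rest: registers
  that disagree with the current output of their writer, and, for each node in the middle of
  Phase 2, by how much its sum would miss \<open>u\<close> if all remaining reads returned the components
  of \<open>u\<close>. Without such a term no bound can hold for every initial configuration: a node may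
  read a stale register before its writer first writes it, or complete a corrupted sum.\<close>

definition corruption :: "real^'n^'n \<Rightarrow> 'n::finite config \<Rightarrow> real^'n \<Rightarrow> real" where
  "corruption w C u =
     (\<Sum>i\<in>UNIV. \<Sum>j\<in>neighbors w i. \<bar>reg C i j - out C i\<bar>) +
     (\<Sum>i\<in>UNIV. case loc C i of
        Writing S \<Rightarrow> 0
      | Reading S \<Rightarrow> \<bar>out C i + (\<Sum>j\<in>S. w $ i $ j * u $ j) - u $ i\<bar>)"

lemma corruption_eq_0:
  assumes "\<And>i j. j \<in> neighbors w i \<Longrightarrow> reg C i j = out C i"
    and "\<And>i. \<exists>S. loc C i = Writing S"
  shows "corruption w C u = 0"
proof -
  have "(case loc C i of Writing S \<Rightarrow> 0
      | Reading S \<Rightarrow> \<bar>out C i + (\<Sum>j\<in>S. w $ i $ j * u $ j) - u $ i\<bar>) = 0" for i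
    using assms(2)[of i] by auto
  then show ?thesis
    unfolding corruption_def using assms(1) by simp
qed

end

theory Submission
  imports Defs
begin

text \<open>Dominance makes the update by the off-diagonal weights a contraction: if all registers are within \<open>E\<close> of the
  solution, every completed sum is within \<open>\<delta> + b * E\<close>, with \<open>b < 1\<close>. One round lets every node
  complete a sum, a second one replaces all registers by such outputs, and a third one makes every
  sum in progress start from registers of the new quality. So the error bound improves from \<open>E\<close> to
  \<open>\<delta> + b * E\<close> every three rounds, the outputs being ahead by two rounds; hence \<open>c2\<close> is the cube
  root of \<open>b\<close>. Choosing \<open>b\<close> larger than the row sums \<open>a\<close> leaves the slack \<open>(b - a) * E\<close>, which
  absorbs the initially corrupted sums.\<close>

section \<open>The linear system\<close>

text \<open>Divided by \<open>w $ i $ i\<close>, the equations for \<open>u\<close> become the rows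
  of \<open>W u = v\<close>. Invertibility of \<open>W\<close> thus yields both the existence and
  the uniqueness that the \<open>THE\<close> in \<open>solution\<close> requires.\<close>

lemma solution_equation:
  assumes nz: "\<And>i. w $ i $ i \<noteq> 0" and inv: "invertible (system_matrix w)"
  shows "solution w v $ i = w $ i $ i * v $ i + (\<Sum>j\<in>UNIV - {i}. w $ i $ j * solution w v $ j)"
proof -
  let ?W = "system_matrix w"
  let ?P = "\<lambda>u. \<forall>i. u $ i = w $ i $ i * v $ i + (\<Sum>j\<in>UNIV - {i}. w $ i $ j * u $ j)"
  have row: "(?W *v u) $ i = (u $ i - (\<Sum>j\<in>UNIV - {i}. w $ i $ j * u $ j)) / w $ i $ i" for u i
  proof -
    have "(?W *v u) $ i = u $ i / w $ i $ i + (\<Sum>j\<in>UNIV - {i}. ?W $ i $ j * u $ j)"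
      by (simp add: matrix_vector_mult_def sum.remove[of UNIV i] system_matrix_def)
    also have "(\<Sum>j\<in>UNIV - {i}. ?W $ i $ j * u $ j) = (\<Sum>j\<in>UNIV - {i}. - (w $ i $ j * u $ j) / w $ i $ i)"
      by (rule sum.cong) (auto simp: system_matrix_def)
    finally show ?thesis
      by (simp add: sum_divide_distrib sum_negf diff_divide_distrib)
  qed
  have P_iff: "?P u \<longleftrightarrow> ?W *v u = v" for u
    using nz by (auto simp: vec_eq_iff row field_simps)
  obtain V where V: "?W ** V = mat 1" "V ** ?W = mat 1"
    using inv by (auto simp: invertible_def)
  have "?P (V *v v)"
    unfolding P_iff by (simp add: matrix_vector_mul_assoc V)
  moreover have "u = V *v v" if "?P u" for u
    using that unfolding P_iff by (metis V(2) matrix_vector_mul_assoc matrix_vector_mul_lid)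
  ultimately have "?P (solution w v)"
    unfolding solution_def by (rule theI)
  then show ?thesis by blast
qed

text \<open>Row \<open>i\<close> of the matrix is row \<open>i\<close> of the weights divided by
  \<open>w $ i $ i\<close>, with diagonal entry \<open>1 / w $ i $ i\<close>. Dominance therefore
  says that the off-diagonal weights have absolute row sum below 1, and finiteness gives one
  \<open>a\<close> for all rows.\<close>

lemma contraction_factor:
  assumes nz: "\<And>i. w $ i $ i \<noteq> 0" and dom: "diagonally_dominant (system_matrix w)"
  obtains a where "0 \<le> a" "a < 1" "\<And>i. (\<Sum>j\<in>UNIV - {i}. \<bar>w $ i $ j\<bar>) \<le> a"
proof
  let ?s = "\<lambda>i. \<Sum>j\<in>UNIV - {i}. \<bar>w $ i $ j\<bar>"
  have less: "?s i < 1" for i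
  proof -
    have "(\<Sum>j\<in>UNIV - {i}. \<bar>system_matrix w $ i $ j\<bar>) = (\<Sum>j\<in>UNIV - {i}. \<bar>w $ i $ j\<bar> / \<bar>w $ i $ i\<bar>)"
      by (rule sum.cong) (auto simp: system_matrix_def)
    then have "?s i / \<bar>w $ i $ i\<bar> < 1 / \<bar>w $ i $ i\<bar>"
      using dom by (auto simp: diagonally_dominant_def system_matrix_def sum_divide_distrib dest: spec[of _ i])
    then show ?thesis using nz[of i] by (simp add: divide_less_cancel)
  qed
  show "(MAX i. ?s i) < 1" using less by (subst Max_less_iff) auto
  show le: "?s i \<le> (MAX i. ?s i)" for i by (rule Max_ge) auto
  show "0 \<le> (MAX i. ?s i)" using le[of undefined] by (meson order_trans sum_nonneg abs_ge_zero)
qed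

section \<open>The maximum norm and neighbourhoods\<close>

lemma infnorm_cart_le_iff: "infnorm (x::real^'n) \<le> e \<longleftrightarrow> (\<forall>i. \<bar>x $ i\<bar> \<le> e)"
proof
  assume "\<forall>i. \<bar>x $ i\<bar> \<le> e"
  then show "infnorm x \<le> e"
    unfolding infnorm_cart by (intro cSup_least) auto
qed (meson component_le_infnorm_cart order_trans)

lemma neighbors_sym: "j \<in> neighbors w i \<longleftrightarrow> i \<in> neighbors w j"
  by (auto simp: neighbors_def)

lemma sum_neighbors:
  assumes "\<And>j. w $ i $ j = 0 \<Longrightarrow> f j = (0::real)"
  shows "(\<Sum>j\<in>UNIV - {i}. f j) = (\<Sum>j\<in>neighbors w i. f j)"
  by (rule sum.mono_neutral_right) (auto simp: neighbors_def intro: assms)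

section \<open>Control flow of a run\<close>

locale run =
  fixes w :: "real^'n^'n" and inp :: "nat \<Rightarrow> real^'n" and C :: "nat \<Rightarrow> 'n config"
    and act :: "nat \<Rightarrow> 'n \<times> 'n action"
  assumes is_run: "is_run w inp C act"
begin

abbreviation "N \<equiv> neighbors w"

text \<open>The step relation seen by one fixed node: only its location, its output variable and the
  registers it writes are tracked, and every step of another node is \<open>idle\<close>.\<close>

lemma node_step [case_names idle writing input reading]:
  obtains
    "fst (act r) \<noteq> i" "loc (C (Suc r)) i = loc (C r) i" "out (C (Suc r)) i = out (C r) i"
    "reg (C (Suc r)) i = reg (C r) i"
  | S j where "act r = (i, Write j)" "loc (C r) i = Writing S" "j \<in> S"
    "loc (C (Suc r)) i = Writing (S - {j})" "out (C (Suc r)) i = out (C r) i"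
    "reg (C (Suc r)) i = (reg (C r) i)(j := out (C r) i)"
  | "act r = (i, ReadInput)" "loc (C r) i = Writing {}"
    "loc (C (Suc r)) i = reading_location w i (N i)"
    "out (C (Suc r)) i = w $ i $ i * inp r $ i" "reg (C (Suc r)) i = reg (C r) i"
  | S j where "act r = (i, Read j)" "loc (C r) i = Reading S" "j \<in> S"
    "loc (C (Suc r)) i = reading_location w i (S - {j})"
    "out (C (Suc r)) i = out (C r) i + w $ i $ j * reg (C r) j i"
    "reg (C (Suc r)) i = reg (C r) i"
proof -
  have "step w (inp r) (C r) (fst (act r)) (snd (act r)) (C (Suc r))"
    using is_run by (auto simp: is_run_def)
  then show thesis
  proof (cases rule: step.cases)
    case (write_reg S j)
    then show ?thesis
      by (cases "fst (act r) = i") (auto intro: that(1) that(2)[of j S] simp: prod_eq_iff)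
  next
    case read_inp
    then show ?thesis
      by (cases "fst (act r) = i") (auto intro: that(1) that(3) simp: prod_eq_iff)
  next
    case (read_reg S j)
    then show ?thesis
      by (cases "fst (act r) = i") (auto intro: that(1) that(4)[of j S] simp: prod_eq_iff)
  qed
qed

lemma valid_location:
  "case loc (C r) i of Writing S \<Rightarrow> S \<subseteq> N i | Reading S \<Rightarrow> S \<subseteq> N i \<and> S \<noteq> {}"
proof (induction r)
  case 0
  then show ?case using is_run by (auto simp: is_run_def valid_config_def)
next
  case (Suc r)
  then show ?case
    by (cases rule: node_step[of r i]) (auto simp: reading_location_def)
qed

lemma valid_reading: "loc (C r) i = Reading S \<Longrightarrow> S \<subseteq> N i \<and> S \<noteq> {}"
  using valid_location[of i r] by simp

lemma node_output_writing: "loc (C r) i = Writing S \<Longrightarrow> node_output C i r = out (C r) i"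
  by (cases r) auto

text \<open>A step by which \<open>i\<close> finishes a sum. For a node without neighbours this is
  the input read itself, so writes are excluded instead of demanding a register read.\<close>

definition completes :: "'n \<Rightarrow> nat \<Rightarrow> bool" where
  "completes i r \<longleftrightarrow>
     fst (act r) = i \<and> (\<forall>j. snd (act r) \<noteq> Write j) \<and> (\<exists>S. loc (C (Suc r)) i = Writing S)"

text \<open>A window may begin in the middle of the loop, so the actions in it need not come in
  program order. Still, the input read opens a sum, and leaving that sum open keeps the read of some
  neighbour out of the window.\<close>

lemma loop_body_completes:
  assumes all: "\<And>a. a \<in> loop_body w i \<Longrightarrow> \<exists>r\<in>{s..<t}. act r = (i, a)"
  shows "\<exists>r\<in>{s..<t}. completes i r"
proof (rule ccontr)
  assume none: "\<not> ?thesis"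
  \<comment> \<open>As long as nothing completes, there are three situations: no input or register
    read so far; a sum already open at \<open>s\<close>, hence no input read; or a sum opened since
    \<open>s\<close>, hence no read of the neighbours in \<open>S\<close>. At \<open>t\<close> only
    the last one is compatible with an input read.\<close>
  have inv: "(\<exists>S. loc (C r) i = Writing S) \<and> (\<forall>q\<in>{s..<r}. act q \<noteq> (i, ReadInput)) \<and>
      (\<forall>q\<in>{s..<r}. \<forall>j. act q \<noteq> (i, Read j)) \<or>
    (\<exists>S. loc (C r) i = Reading S \<and>
      ((\<forall>q\<in>{s..<r}. act q \<noteq> (i, ReadInput)) \<or> (\<forall>q\<in>{s..<r}. \<forall>j\<in>S. act q \<noteq> (i, Read j))))"
    if "s \<le> r" "r \<le> t" for r
    using that
  proof (induction r rule: dec_induct)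
    case base
    then show ?case by (cases "loc (C s) i") auto
  next
    case (step r)
    then have nc: "\<not> completes i r" using none by auto
    have less: "{s..<Suc r} = insert r {s..<r}" using step by auto
    have IH: "(\<exists>S. loc (C r) i = Writing S) \<and> (\<forall>q\<in>{s..<r}. act q \<noteq> (i, ReadInput)) \<and>
        (\<forall>q\<in>{s..<r}. \<forall>j. act q \<noteq> (i, Read j)) \<or>
      (\<exists>S. loc (C r) i = Reading S \<and>
        ((\<forall>q\<in>{s..<r}. act q \<noteq> (i, ReadInput)) \<or> (\<forall>q\<in>{s..<r}. \<forall>j\<in>S. act q \<noteq> (i, Read j))))"
      using step by auto
    show ?case
    proof (cases rule: node_step[of r i])
      case idle
      then show ?thesis using IH unfolding less by auto
    next
      case (writing S j)
      then show ?thesis using IH unfolding less by auto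
    next
      case input
      then have "loc (C (Suc r)) i = Reading (N i)"
        using nc by (auto simp: completes_def reading_location_def split: if_splits)
      then show ?thesis using IH input unfolding less by auto
    next
      case (reading S j)
      then have "loc (C (Suc r)) i = Reading (S - {j})"
        using nc by (auto simp: completes_def reading_location_def split: if_splits)
      then show ?thesis using IH reading unfolding less by auto
    qed
  qed
  obtain q where q: "q \<in> {s..<t}" "act q = (i, ReadInput)"
    using all[of ReadInput] by (auto simp: loop_body_def)
  then have "s \<le> t" by auto
  from inv[OF this order_refl] q obtain S where
    S: "loc (C t) i = Reading S" "\<forall>q\<in>{s..<t}. \<forall>j\<in>S. act q \<noteq> (i, Read j)" by blast
  then obtain j where j: "j \<in> S" "j \<in> N i" using valid_reading by blast
  then show False using all[of "Read j"] S by (auto simp: loop_body_def)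
qed

end

section \<open>Fair runs and rounds\<close>

locale fair_run = run +
  assumes fair: "fair act"
begin

lemma acts_again: "\<exists>r\<ge>s. fst (act r) = i"
  using fair by (auto simp: fair_def INFM_nat_le)

lemma reads_input_again: "\<exists>r\<ge>s. act r = (i, ReadInput)"
proof (rule ccontr)
  assume "\<not> ?thesis"
  then have never: "act r \<noteq> (i, ReadInput)" if "s \<le> r" for r using that by auto
  \<comment> \<open>The number of own steps before the next input read. A reading node still has a
    full writing phase ahead, whence \<open>card (N i)\<close>.\<close>
  define \<mu> where
    "\<mu> r = (case loc (C r) i of Writing S \<Rightarrow> card S | Reading S \<Rightarrow> card (N i) + card S)" for r
  have dec: "\<mu> (Suc r) < \<mu> r" if "s \<le> r" "fst (act r) = i" for r
  proof (cases rule: node_step[of r i])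
    case (writing S j)
    have "card (S - {j}) < card S" using writing by (intro card_Diff1_less) auto
    then show ?thesis using writing by (auto simp: \<mu>_def)
  next
    case (reading S j)
    have "card (S - {j}) < card S" using reading by (intro card_Diff1_less) auto
    then show ?thesis using reading by (auto simp: \<mu>_def reading_location_def)
  qed (use that never in auto)
  have mono: "\<mu> (Suc r) \<le> \<mu> r" if "s \<le> r" for r
  proof (cases "fst (act r) = i")
    case False
    then show ?thesis by (cases rule: node_step[of r i]) (auto simp: \<mu>_def)
  qed (use dec that in force)
  have "\<exists>r\<ge>s. \<mu> r + n \<le> \<mu> s" for n
  proof (induction n)
    case (Suc n)
    then obtain q where q: "s \<le> q" "\<mu> q + n \<le> \<mu> s" by auto
    obtain r where r: "q \<le> r" "fst (act r) = i" using acts_again by blast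
    have "\<mu> r \<le> \<mu> q"
      using r(1) by (induction r rule: dec_induct) (use mono q in \<open>auto intro: order_trans\<close>)
    then show ?case using dec[of r] q r by (intro exI[of _ "Suc r"]) auto
  qed auto
  from this[of "Suc (\<mu> s)"] show False by auto
qed

text \<open>Between two input reads the node traverses its whole loop. An action on \<open>j\<close>
  that is never performed leaves \<open>j\<close> pending, which keeps the node from returning to
  \<open>Writing {}\<close>.\<close>

lemma performs_again:
  assumes a: "a \<in> loop_body w i"
  shows "\<exists>r\<ge>s. act r = (i, a)"
proof (rule ccontr)
  assume "\<not> ?thesis"
  then have never: "act r \<noteq> (i, a)" if "s \<le> r" for r using that by auto
  obtain q where q: "s \<le> q" "act q = (i, ReadInput)" using reads_input_again by blast
  obtain r where r: "Suc q \<le> r" "act r = (i, ReadInput)" using reads_input_again by blast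
  have at_r: "loc (C r) i = Writing {}"
    by (cases rule: node_step[of r i]) (use r in auto)
  from a consider "a = ReadInput" | j where "j \<in> N i" "a = Write j" | j where "j \<in> N i" "a = Read j"
    by (auto simp: loop_body_def)
  then show False
  proof cases
    case 1
    then show ?thesis using q never by auto
  next
    case (2 j)
    have "(\<exists>S. loc (C r) i = Reading S) \<or> (\<exists>S. loc (C r) i = Writing S \<and> j \<in> S)"
      using r(1)
    proof (induction r rule: dec_induct)
      case base
      show ?case by (cases rule: node_step[of q i]) (use q 2 in \<open>auto simp: reading_location_def\<close>)
    next
      case (step r)
      then show ?case
        by (cases rule: node_step[of r i])
          (use q 2 never[of r] in \<open>auto simp: reading_location_def\<close>)
    qed
    then show ?thesis using at_r by auto
  next
    case (3 j)
    have "\<exists>S. loc (C r) i = Reading S \<and> j \<in> S"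
      using r(1)
    proof (induction r rule: dec_induct)
      case base
      show ?case by (cases rule: node_step[of q i]) (use q 3 in \<open>auto simp: reading_location_def\<close>)
    next
      case (step r)
      then show ?case
        by (cases rule: node_step[of r i])
          (use q 3 never[of r] in \<open>auto simp: reading_location_def\<close>)
    qed
    then show ?thesis using at_r by auto
  qed
qed

abbreviation "R \<equiv> round_end w act"

text \<open>There are only finitely many pairs of a node and an action, and each occurs again after
  \<open>R k\<close>. Hence some finite time satisfies the condition under \<open>LEAST\<close>, and
  so does the least one.\<close>

lemma round_performs:
  assumes "a \<in> loop_body w i"
  shows "\<exists>r\<in>{R k..<R (Suc k)}. act r = (i, a)"
proof -
  let ?A = "SIGMA i:UNIV. loop_body w i"
  let ?P = "\<lambda>t. \<forall>i. \<forall>a\<in>loop_body w i. \<exists>r\<in>{R k..<t}. act r = (i, a)"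
  have "finite ?A" by (auto simp: loop_body_def)
  have "\<forall>p\<in>?A. \<exists>r\<ge>R k. act r = p" using performs_again by auto
  then obtain f where f: "\<And>p. p \<in> ?A \<Longrightarrow> R k \<le> f p \<and> act (f p) = p" by metis
  have "f p < Suc (Max (f ` ?A))" if "p \<in> ?A" for p
    using that \<open>finite ?A\<close> by (simp add: less_Suc_eq_le)
  then have "?P (Suc (Max (f ` ?A)))"
    using f by (fastforce intro!: bexI)
  then have "?P (LEAST t. ?P t)" by (rule LeastI)
  then show ?thesis using assms by simp
qed

lemma round_end_mono: "R k \<le> R (Suc k)"
  using round_performs[of ReadInput _ k] by (force simp: loop_body_def)

end

text \<open>The common pattern of the progress arguments: an event \<open>Q\<close> establishes
  \<open>P\<close>, \<open>P\<close> persists, and the round guarantees the event. \<open>Q\<close>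
  will be a completed sum, a write or an input read.\<close>

lemma established_in_round:
  fixes P Q :: "nat \<Rightarrow> bool"
  assumes "\<And>r. s \<le> r \<Longrightarrow> P r \<or> Q r \<Longrightarrow> P (Suc r)" and "\<exists>q\<in>{s..<t}. Q q" and "t \<le> r"
  shows "P r"
proof -
  obtain q where q: "s \<le> q" "q < t" "Q q" using assms by auto
  then have "Suc q \<le> r" using assms by auto
  then show ?thesis
    by (induction r rule: dec_induct) (use assms(1) q in auto)
qed

section \<open>Error bounds\<close>

locale contracting_run = fair_run w inp C act
  for w :: "real^'n^'n" and inp :: "nat \<Rightarrow> real^'n" and C :: "nat \<Rightarrow> 'n config"
    and act :: "nat \<Rightarrow> 'n \<times> 'n action" +
  fixes u v :: "real^'n" and \<delta> a b :: real
  assumes u: "\<And>i. u $ i = w $ i $ i * v $ i + (\<Sum>j\<in>UNIV - {i}. w $ i $ j * u $ j)"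
    and diag_le: "\<And>i. \<bar>w $ i $ i\<bar> \<le> 1"
    and row_le: "\<And>i. (\<Sum>j\<in>UNIV - {i}. \<bar>w $ i $ j\<bar>) \<le> a"
    and ab: "a \<le> b"
    and bounded: "bounded_around \<delta> v inp"
begin

lemma subset_row_le: "S \<subseteq> N i \<Longrightarrow> (\<Sum>j\<in>S. \<bar>w $ i $ j\<bar>) \<le> a"
  by (rule order_trans[OF sum_mono2 row_le]) (auto simp: neighbors_def)

definition reg_ok :: "real \<Rightarrow> 'n \<Rightarrow> 'n \<Rightarrow> nat \<Rightarrow> bool" where
  "reg_ok E i j r \<longleftrightarrow> \<bar>reg (C r) i j - u $ i\<bar> \<le> E"

definition out_ok :: "real \<Rightarrow> 'n \<Rightarrow> nat \<Rightarrow> bool" where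
  "out_ok E i r \<longleftrightarrow> \<bar>node_output C i r - u $ i\<bar> \<le> E"

text \<open>A sum in progress must have room for the errors of the registers still to be read.\<close>

definition sum_ok :: "real \<Rightarrow> 'n \<Rightarrow> nat \<Rightarrow> bool" where
  "sum_ok E i r \<longleftrightarrow> (\<forall>S. loc (C r) i = Reading S \<longrightarrow>
     \<bar>out (C r) i + (\<Sum>j\<in>S. w $ i $ j * u $ j) - u $ i\<bar> + (\<Sum>j\<in>S. \<bar>w $ i $ j\<bar>) * E \<le> \<delta> + b * E)"

definition regs_ok :: "real \<Rightarrow> nat \<Rightarrow> bool" where
  "regs_ok E r \<longleftrightarrow> (\<forall>i. \<forall>j\<in>N i. reg_ok E i j r)"

text \<open>Registers and outputs are measured against \<open>E\<close>, but sums already against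
  the next bound \<open>\<delta> + b * E\<close>, because that is the quality of the outputs they
  turn into.\<close>

definition level :: "real \<Rightarrow> nat \<Rightarrow> bool" where
  "level E r \<longleftrightarrow> regs_ok E r \<and> (\<forall>i. out_ok E i r \<and> sum_ok E i r)"

text \<open>With exact neighbour values, the only error is that of the input, scaled by a diagonal
  weight of modulus at most 1. The room for the reads to come is bounded by the row sum.\<close>

lemma fresh_sum:
  assumes "0 \<le> E"
  shows "\<bar>w $ i $ i * inp r $ i + (\<Sum>j\<in>N i. w $ i $ j * u $ j) - u $ i\<bar> +
    (\<Sum>j\<in>N i. \<bar>w $ i $ j\<bar>) * E \<le> \<delta> + b * E"
proof -
  have "(\<Sum>j\<in>N i. w $ i $ j * u $ j) = u $ i - w $ i $ i * v $ i"
    using u[of i] sum_neighbors[of w i "\<lambda>j. w $ i $ j * u $ j"] by simp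
  then have "\<bar>w $ i $ i * inp r $ i + (\<Sum>j\<in>N i. w $ i $ j * u $ j) - u $ i\<bar> =
      \<bar>w $ i $ i\<bar> * \<bar>inp r $ i - v $ i\<bar>"
    by (simp add: abs_mult[symmetric] algebra_simps)
  also have "\<dots> \<le> 1 * \<delta>"
    using bounded diag_le[of i]
    by (intro mult_mono) (auto simp: bounded_around_def infnorm_cart_le_iff)
  finally have "\<bar>w $ i $ i * inp r $ i + (\<Sum>j\<in>N i. w $ i $ j * u $ j) - u $ i\<bar> \<le> \<delta>" by simp
  moreover have "(\<Sum>j\<in>N i. \<bar>w $ i $ j\<bar>) * E \<le> b * E"
    using subset_row_le[of "N i" i] ab assms by (intro mult_right_mono) auto
  ultimately show ?thesis by simp
qed

text \<open>Reading \<open>j\<close> exchanges the reserve \<open>\<bar>w $ i $ j\<bar> * E\<close>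
  for the actual error of the register, which is no larger.\<close>

lemma read_sum:
  assumes "regs_ok E r" "sum_ok E i r" "loc (C r) i = Reading S" "j \<in> S"
  shows "\<bar>out (C r) i + w $ i $ j * reg (C r) j i + (\<Sum>k\<in>S - {j}. w $ i $ k * u $ k) - u $ i\<bar> +
    (\<Sum>k\<in>S - {j}. \<bar>w $ i $ k\<bar>) * E \<le> \<delta> + b * E"
proof -
  have "j \<in> N i" using valid_reading assms by blast
  then have "\<bar>reg (C r) j i - u $ j\<bar> \<le> E"
    using assms(1) neighbors_sym[of j w i] by (auto simp: regs_ok_def reg_ok_def)
  then have "\<bar>w $ i $ j * (reg (C r) j i - u $ j)\<bar> \<le> \<bar>w $ i $ j\<bar> * E"
    by (simp add: abs_mult mult_left_mono)
  moreover have "\<bar>out (C r) i + (\<Sum>k\<in>S. w $ i $ k * u $ k) - u $ i\<bar> + (\<Sum>k\<in>S. \<bar>w $ i $ k\<bar>) * E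
      \<le> \<delta> + b * E"
    using assms by (auto simp: sum_ok_def)
  ultimately show ?thesis
    using assms(4) by (simp add: sum.remove[of S j] algebra_simps)
qed

section \<open>Preservation of the error bounds by a single step\<close>

lemma sum_ok_Suc:
  assumes "0 \<le> E" "regs_ok E r" "sum_ok E i r \<or> act r = (i, ReadInput)"
  shows "sum_ok E i (Suc r)"
proof (cases rule: node_step[of r i])
  case idle
  then show ?thesis using assms by (auto simp: sum_ok_def)
next
  case (writing S j)
  then show ?thesis by (auto simp: sum_ok_def)
next
  case input
  then show ?thesis using fresh_sum[OF assms(1), of i r]
    by (auto simp: sum_ok_def reading_location_def)
next
  case (reading S j)
  then show ?thesis using assms read_sum[of E r i S j]
    by (auto simp: sum_ok_def reading_location_def)
qed

text \<open>\<open>G\<close> is separate from \<open>E\<close> for two uses: \<open>G = E\<close>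
  gives persistence of a level, \<open>G = \<delta> + b * E\<close> the improvement after a
  completed sum.\<close>

lemma out_ok_Suc:
  assumes "0 \<le> E" "regs_ok E r" "sum_ok E i r" "\<delta> + b * E \<le> G" "out_ok G i r \<or> completes i r"
  shows "out_ok G i (Suc r)"
proof (cases rule: node_step[of r i])
  case idle
  then show ?thesis
    using assms(5) node_output_writing[of r i]
    by (cases "loc (C r) i") (auto simp: out_ok_def completes_def)
next
  case (writing S j)
  then show ?thesis
    using assms(5) node_output_writing[of r i S] by (auto simp: out_ok_def completes_def)
next
  case input
  then show ?thesis
    using assms(4,5) fresh_sum[OF assms(1), of i r]
    by (cases "N i = {}") (auto simp: out_ok_def completes_def reading_location_def)
next
  case (reading S j)
  then show ?thesis
    using assms(4,5) read_sum[OF assms(2,3), of S j]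
    by (cases "S - {j} = {}") (auto simp: out_ok_def completes_def reading_location_def)
qed

text \<open>Writes happen only outside Phase 2, where the output variable is the node's output, so
  no partial sum reaches a register.\<close>

lemma reg_ok_Suc:
  assumes "out_ok G i r" "reg_ok G i j r \<or> act r = (i, Write j)"
  shows "reg_ok G i j (Suc r)"
  using assms node_output_writing[of r i]
  by (cases rule: node_step[of r i]) (auto simp: reg_ok_def out_ok_def)

section \<open>Persistence and improvement of levels over rounds\<close>

lemma level_mono:
  assumes "0 \<le> E" "\<delta> + b * E \<le> E" "level E s" "s \<le> r"
  shows "level E r"
  using assms(4)
proof (induction r rule: dec_induct)
  case (step r)
  then show ?case
    using assms(1,2) out_ok_Suc[of E r _ E] sum_ok_Suc[of E r] reg_ok_Suc[of E _ r]
    by (auto simp: level_def regs_ok_def)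
qed fact

text \<open>Since \<open>sum_ok\<close> already aims at the next bound, one completed sum per node
  suffices, and every round contains one.\<close>

lemma level_outputs:
  assumes E: "0 \<le> E" "\<delta> + b * E \<le> E" and "level E (R k)" "R (Suc k) \<le> r"
  shows "out_ok (\<delta> + b * E) i r"
proof (rule established_in_round[where Q = "completes i"])
  show "\<exists>q\<in>{R k..<R (Suc k)}. completes i q"
    using round_performs by (intro loop_body_completes)
  show "out_ok (\<delta> + b * E) i (Suc q)" if "R k \<le> q" "out_ok (\<delta> + b * E) i q \<or> completes i q" for q
    using level_mono[OF E assms(3) that(1)] that(2) E
    by (intro out_ok_Suc[of E]) (auto simp: level_def)
qed fact

lemma level_three_rounds:
  assumes E: "0 \<le> E" "\<delta> + b * E \<le> E" "0 \<le> \<delta> + b * E" and "level E (R k)"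
  shows "level (\<delta> + b * E) (R (Suc (Suc (Suc k))))"
proof -
  let ?F = "\<delta> + b * E"
  note out = level_outputs[OF E(1,2) assms(4)]
  have reg: "reg_ok ?F i j r" if "R (Suc (Suc k)) \<le> r" "j \<in> N i" for i j r
  proof (rule established_in_round[where Q = "\<lambda>r. act r = (i, Write j)"])
    show "\<exists>q\<in>{R (Suc k)..<R (Suc (Suc k))}. act q = (i, Write j)"
      using that by (intro round_performs) (auto simp: loop_body_def)
    show "reg_ok ?F i j (Suc q)" if "R (Suc k) \<le> q" "reg_ok ?F i j q \<or> act q = (i, Write j)" for q
      using that out by (intro reg_ok_Suc) auto
  qed fact
  \<comment> \<open>A sum open when the registers become good may contain older reads, so only sums
    opened by a later input read are counted on.\<close>
  have sum: "sum_ok ?F i r" if "R (Suc (Suc (Suc k))) \<le> r" for i r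
  proof (rule established_in_round[where Q = "\<lambda>r. act r = (i, ReadInput)"])
    show "\<exists>q\<in>{R (Suc (Suc k))..<R (Suc (Suc (Suc k)))}. act q = (i, ReadInput)"
      by (intro round_performs) (auto simp: loop_body_def)
    show "sum_ok ?F i (Suc q)"
      if "R (Suc (Suc k)) \<le> q" "sum_ok ?F i q \<or> act q = (i, ReadInput)" for q
      using that reg E by (intro sum_ok_Suc) (auto simp: regs_ok_def)
  qed fact
  show ?thesis
    using out reg sum round_end_mono[of "Suc k"] round_end_mono[of "Suc (Suc k)"]
    by (auto simp: level_def regs_ok_def)
qed

section \<open>The initial configuration and the explicit bound\<close>

lemma initial_level:
  assumes "a < 1" and b: "b = (1 + a) / 2"
    and E: "initial_error (C 0) u + 2 / (1 - a) * corruption w (C 0) u \<le> E"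
  shows "0 \<le> E" "level E 0"
proof -
  let ?z = "initial_error (C 0) u" and ?K = "corruption w (C 0) u"
  let ?reg = "\<lambda>i. \<Sum>j\<in>N i. \<bar>reg (C 0) i j - out (C 0) i\<bar>"
  let ?mid = "\<lambda>i. case loc (C 0) i of Writing S \<Rightarrow> 0
      | Reading S \<Rightarrow> \<bar>out (C 0) i + (\<Sum>j\<in>S. w $ i $ j * u $ j) - u $ i\<bar>"
  have pos: "0 \<le> ?reg i" "0 \<le> ?mid i" for i
    by (auto intro: sum_nonneg split: location.split)
  have K: "?reg i \<le> ?K" "?mid i \<le> ?K" for i
  proof -
    have "?reg i \<le> (\<Sum>i\<in>UNIV. ?reg i)" "?mid i \<le> (\<Sum>i\<in>UNIV. ?mid i)"
      using pos by (auto intro!: member_le_sum)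
    moreover have "0 \<le> (\<Sum>i\<in>UNIV. ?reg i)" "0 \<le> (\<Sum>i\<in>UNIV. ?mid i)"
      using pos by (auto intro!: sum_nonneg)
    ultimately show "?reg i \<le> ?K" "?mid i \<le> ?K" unfolding corruption_def by linarith+
  qed
  have z: "\<bar>out (C 0) i - u $ i\<bar> \<le> ?z" for i
    unfolding initial_error_def by (rule Max_ge) auto
  have nonneg: "0 \<le> ?K" "0 \<le> ?z"
    using order_trans[OF pos(1) K(1)] order_trans[OF abs_ge_zero z] by auto
  have "0 \<le> a" using subset_row_le[of "{}"] by simp
  \<comment> \<open>The factor \<open>2 / (1 - a)\<close> is at least 1, so \<open>E\<close> also
    covers \<open>?z + ?K\<close>, which bounds the error of every register.\<close>
  then have "?K * 1 \<le> ?K * (2 / (1 - a))"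
    using \<open>a < 1\<close> nonneg by (intro mult_left_mono) (auto simp: field_simps)
  then have KE: "?z + ?K \<le> E" using E by (simp add: mult.commute)
  then show "0 \<le> E" using nonneg by linarith
  have \<delta>: "0 \<le> \<delta>"
    using bounded infnorm_pos_le[of "inp 0 - v"] unfolding bounded_around_def
    by (meson order_trans)
  have regs: "reg_ok E i j 0" if "j \<in> N i" for i j
  proof -
    have "\<bar>reg (C 0) i j - out (C 0) i\<bar> \<le> ?reg i"
      using that by (intro member_le_sum) auto
    then show ?thesis using K(1)[of i] z[of i] KE by (auto simp: reg_ok_def)
  qed
  have sums: "sum_ok E i 0" for i
    unfolding sum_ok_def
  proof (intro allI impI)
    fix S assume S: "loc (C 0) i = Reading S"
    have "(\<Sum>j\<in>S. \<bar>w $ i $ j\<bar>) * E \<le> a * E"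
      using subset_row_le valid_reading S \<open>0 \<le> E\<close> by (intro mult_right_mono) auto
    \<comment> \<open>As \<open>b - a = (1 - a) / 2\<close>, the factor \<open>2 / (1 - a)\<close>
      is exactly the reciprocal of the slack.\<close>
    moreover have "?K \<le> (b - a) * E"
    proof -
      have "2 / (1 - a) * ?K \<le> E" using E nonneg by linarith
      then show ?thesis using \<open>a < 1\<close> unfolding b by (simp add: field_simps)
    qed
    ultimately show "\<bar>out (C 0) i + (\<Sum>j\<in>S. w $ i $ j * u $ j) - u $ i\<bar> +
        (\<Sum>j\<in>S. \<bar>w $ i $ j\<bar>) * E \<le> \<delta> + b * E"
      using K(2)[of i] S \<delta> by (simp add: algebra_simps)
  qed
  have "out_ok E i 0" for i
    using z[of i] KE nonneg by (auto simp: out_ok_def)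
  then show "level E 0"
    using regs sums by (auto simp: level_def regs_ok_def)
qed

lemma output_error:
  assumes "a < 1" and b: "b = (1 + a) / 2" and "R k \<le> r"
  shows "\<bar>node_output C i r - u $ i\<bar> \<le> \<delta> * (1 / (1 - b)) +
    root 3 b ^ k * (initial_error (C 0) u + 2 / (1 - a) * corruption w (C 0) u)"
proof -
  have "0 \<le> a" using subset_row_le[of "{}"] by simp
  then have b01: "0 < b" "b < 1" using \<open>a < 1\<close> b by auto
  have \<delta>: "0 \<le> \<delta>"
    using bounded infnorm_pos_le[of "inp 0 - v"] unfolding bounded_around_def
    by (meson order_trans)
  define B where "B = initial_error (C 0) u + 2 / (1 - a) * corruption w (C 0) u"
  have B: "0 \<le> B" using initial_level(1)[OF assms(1,2)] unfolding B_def by blast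
  \<comment> \<open>The iterates of \<open>E \<mapsto> \<delta> + b * E\<close> started at distance
    \<open>B\<close> above its fixed point \<open>\<delta> / (1 - b)\<close>; they decrease towards
    it.\<close>
  define E where "E m = \<delta> * (1 / (1 - b)) + b ^ m * B" for m
  have E_Suc: "\<delta> + b * E m = E (Suc m)" for m
    using b01 by (simp add: E_def field_simps)
  have E_pos: "0 \<le> E m" for m
    using \<delta> B b01 by (simp add: E_def)
  have E_dec: "\<delta> + b * E m \<le> E m" for m
    unfolding E_Suc using B b01 by (simp add: E_def mult_right_mono mult_left_le_one_le)
  have level_0: "level (E 0) 0"
    using \<delta> b01 by (intro initial_level(2)[OF assms(1,2)]) (simp add: E_def B_def)
  have level: "level (E m) (R (3 * m))" for m
  proof (induction m)
    case (Suc m)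
    have "0 \<le> \<delta> + b * E m" using E_pos[of "Suc m"] by (simp only: E_Suc)
    from level_three_rounds[OF E_pos E_dec this Suc]
    have "level (E (Suc m)) (R (Suc (Suc (Suc (3 * m)))))" by (simp only: E_Suc)
    moreover have "3 * Suc m = Suc (Suc (Suc (3 * m)))" by simp
    ultimately show ?case by (simp only:)
  qed (use level_0 in simp)
  \<comment> \<open>For \<open>m = Suc n\<close>, outputs of quality \<open>E m\<close> are present
    after \<open>3 * n + 1\<close> rounds, two before the whole level; \<open>3 * m < k + 3\<close>
    says that these rounds are over.\<close>
  have out: "out_ok (E m) i r" if "k \<le> 3 * m" "m = 0 \<or> 3 * m < k + 3" for m
  proof (cases m)
    case 0
    then show ?thesis
      using level_mono[OF E_pos E_dec level_0, of r] by (simp add: level_def)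
  next
    case (Suc n)
    have "R (Suc (3 * n)) \<le> R k"
      using Suc that by (intro lift_Suc_mono_le[of R, OF round_end_mono]) auto
    then have "R (Suc (3 * n)) \<le> r" using assms(3) by simp
    from level_outputs[OF E_pos E_dec level this, of i] show ?thesis
      by (simp only: E_Suc Suc)
  qed
  \<comment> \<open>This is \<open>k / 3\<close> rounded up, so \<open>b ^ m\<close> is at most
    \<open>root 3 b ^ k\<close>. Rounding down, as whole levels would require, would cost a constant
    factor in front of the power.\<close>
  define m where "m = (k + 2) div 3"
  have m: "k \<le> 3 * m" "m = 0 \<or> 3 * m < k + 3" unfolding m_def by linarith+
  have "b ^ m = root 3 b ^ (3 * m)"
    using b01 by (simp add: power_mult)
  also have "\<dots> \<le> root 3 b ^ k"
    using b01 m by (intro power_decreasing) auto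
  finally have "E m \<le> \<delta> * (1 / (1 - b)) + root 3 b ^ k * B"
    using B by (simp add: E_def mult_right_mono)
  then show ?thesis
    using out[OF m] unfolding out_ok_def B_def by linarith
qed

end

theorem theorem2:
  fixes w W :: "real^'n^'n"
  assumes "\<And>i. w $ i $ i \<noteq> 0"
    and "W = system_matrix w"
    and "normalized_diagonally_dominant W"
    and "invertible W"
  shows "\<exists>c1 c2 c3. c1 > 0 \<and> 0 < c2 \<and> c2 < 1 \<and> c3 > 0 \<and>
    eps_always_converges w
      (\<lambda>k \<delta> C u. \<delta> * c1 + c2 ^ k * (initial_error C u + c3 * corruption w C u))"
proof -
  have dom: "diagonally_dominant (system_matrix w)"
    and ge1: "\<bar>system_matrix w $ i $ i\<bar> \<ge> 1" for i
    using assms(2,3) by (auto simp: normalized_diagonally_dominant_def)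
  have inv: "invertible (system_matrix w)" using assms(2,4) by simp
  \<comment> \<open>Normalization bounds \<open>1 / \<bar>w $ i $ i\<bar>\<close> from below by 1;
    thus input errors are not amplified.\<close>
  have diag: "\<bar>w $ i $ i\<bar> \<le> 1" for i
    using ge1[of i] assms(1)[of i] by (simp add: system_matrix_def field_simps)
  obtain a where a: "0 \<le> a" "a < 1" "\<And>i. (\<Sum>j\<in>UNIV - {i}. \<bar>w $ i $ j\<bar>) \<le> a"
    using contraction_factor[OF assms(1) dom] by blast
  \<comment> \<open>The midpoint of \<open>a\<close> and 1 stays below 1 and leaves the positive
    slack \<open>b - a\<close> for corrupted initial sums.\<close>
  define b where "b = (1 + a) / 2"
  have b: "0 < b" "b < 1" "a \<le> b" using a by (auto simp: b_def)
  have "eps_always_converges w (\<lambda>k \<delta> C u. \<delta> * (1 / (1 - b)) +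
      root 3 b ^ k * (initial_error C u + 2 / (1 - a) * corruption w C u))"
    unfolding eps_always_converges_def
  proof (intro allI impI)
    fix \<delta> v inp C act k r
    assume "bounded_around \<delta> v inp" "is_run w inp C act" "fair act" and r: "round_end w act k \<le> r"
    then interpret contracting_run w inp C act "solution w v" v \<delta> a b
      by unfold_locales (assumption | rule solution_equation[OF assms(1) inv] diag a(3) b(3))+
    show "infnorm (output_vector C r - solution w v) \<le> \<delta> * (1 / (1 - b)) + root 3 b ^ k *
        (initial_error (C 0) (solution w v) + 2 / (1 - a) * corruption w (C 0) (solution w v))"
      using output_error[OF a(2) b_def r]
      by (simp add: infnorm_cart_le_iff output_vector_def)
  qed
  moreover have "1 / (1 - b) > 0" "0 < root 3 b" "root 3 b < 1" "2 / (1 - a) > 0"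
    using a b by auto
  ultimately show ?thesis by blast
qed

end
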